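(* Let $V$ be a rank one valuation domain with quotient field $K$ such that the set $\mathcal{W}$ of Ostrowski valuation domains is nonempty. Let $E=\{s_n\}_{n\in\mathbb{N}}\subset K$ be a pseudo-convergent sequence of algebraic type with breadth $\delta$, and, for each $n\in\mathbb{N}$, let $\zeta_n\in[\delta,\infty]$ and let $E_n\subset K$ be a pseudo-convergent sequence with pseudo-limit $s_n$ and breadth $\zeta_n$. Then: (a) $V_E$ is a limit of $\{V_{E_n}\}_{n\in\mathbb{N}}$ in $\mathrm{Zar}(K(X)|V)^{\mathrm{cons}}$; (b) if $\zeta_n\neq\infty$ for every $n$, then $V_E$ is a limit of $\{W_{E_n}\}_{n\in\mathbb{N}}$ in $\mathrm{Zar}(K(X)|V)^{\mathrm{cons}}$.
   Context: $V$ has rank one, with valuation $v$ and value group regarded as a subgroup of $\mathbb{R}$. A sequence $E=\{s_n\}_{n\in\mathbb{N}}$ in $K$ is pseudo-convergent if $v(s_{n+1}-s_n)<v(s_{n+2}-s_{n+1})$ for all $n$. Its breadth is $\lim_{n\to\infty}v(s_{n+1}-s_n)\in\mathbb{R}\cup\{\infty\}$. An element $\alpha\in K$ is a pseudo-limit of $E$ if $v(\alpha-s_n)<v(\alpha-s_{n+1})$ for all $n$. $E$ is of algebraic type if $v(f(s_n))$ is eventually strictly increasing for some $f\in K[X]$. $V_E=\{\phi\in K(X)\mid \phi(s_n)\in V\text{ for all but finitely many }n\in\mathbb{N}\}$, a valuation domain of $K(X)$ lying over $V$. For $\phi\in K(X)$ let $w_E(\phi)=\lim_{n\to\infty}v(\phi(s_n))$;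 when $w_E$ is a valuation on $K(X)$ (which is the case, for instance, if $E$ has finite breadth), $W_E=\{\phi\in K(X)\mid w_E(\phi)\geq 0\}$ is its valuation domain. $\mathcal{W}$ is the set of all $W_E$, where $E\subset K$ is a pseudo-convergent sequence such that $w_E$ is a valuation. $\mathrm{Zar}(K(X)|V)^{\mathrm{cons}}$ is the set of valuation domains of $K(X)$ containing $V$, endowed with the constructible topology, i.e. the coarsest topology in which all the sets $B(\phi_1,\ldots,\phi_k)=\{Z\mid \phi_1,\ldots,\phi_k\in Z\}$, with $\phi_1,\dots,\phi_k\in K(X)$, are both open and closed. *)

theory Defs
  imports "HOL-Analysis.Analysis" "HOL-Computational_Algebra.Polynomial_Factorial"
begin

section \<open>Valuations and valuation domains\<close>

definition valuation_domain :: "'b::field set \<Rightarrow> bool" where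
  "valuation_domain D \<longleftrightarrow>
     0 \<in> D \<and> 1 \<in> D \<and> (\<forall>x\<in>D. \<forall>y\<in>D. x - y \<in> D \<and> x * y \<in> D) \<and>
     (\<forall>x. x \<noteq> 0 \<longrightarrow> x \<in> D \<or> inverse x \<in> D)"

text \<open>Valuations with value group inside the reals; the value at zero is infinity.\<close>

definition real_valuation :: "('b::field \<Rightarrow> ereal) \<Rightarrow> bool" where
  "real_valuation v \<longleftrightarrow>
     (\<forall>x. v x \<noteq> - \<infinity>) \<and> (\<forall>x. v x = \<infinity> \<longleftrightarrow> x = 0) \<and>
     (\<forall>x y. v (x * y) = v x + v y) \<and> (\<forall>x y. min (v x) (v y) \<le> v (x + y))"

text \<open>\<open>V\<close> has rank one, and \<open>v\<close> is a valuation of \<open>V\<close> whose value group is regarded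
  as a (nonzero) subgroup of the reals.\<close>

definition rank_one_valuation_domain :: "'b::field set \<Rightarrow> ('b \<Rightarrow> ereal) \<Rightarrow> bool" where
  "rank_one_valuation_domain V v \<longleftrightarrow>
     valuation_domain V \<and> real_valuation v \<and> (\<exists>x. x \<noteq> 0 \<and> v x \<noteq> 0) \<and> V = {x. 0 \<le> v x}"

section \<open>Pseudo-convergent sequences\<close>

definition pseudo_convergent :: "('a::field \<Rightarrow> ereal) \<Rightarrow> (nat \<Rightarrow> 'a) \<Rightarrow> bool" where
  "pseudo_convergent v s \<longleftrightarrow>
     (\<forall>n. v (s (Suc n) - s n) < v (s (Suc (Suc n)) - s (Suc n)))"

text \<open>For a pseudo-convergent sequence the limit exists, by monotonicity.\<close>

definition breadth :: "('a::field \<Rightarrow> ereal) \<Rightarrow> (nat \<Rightarrow> 'a) \<Rightarrow> ereal" where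
  "breadth v s = lim (\<lambda>n. v (s (Suc n) - s n))"

definition pseudo_limit :: "('a::field \<Rightarrow> ereal) \<Rightarrow> (nat \<Rightarrow> 'a) \<Rightarrow> 'a \<Rightarrow> bool" where
  "pseudo_limit v s \<alpha> \<longleftrightarrow> (\<forall>n. v (\<alpha> - s n) < v (\<alpha> - s (Suc n)))"

definition algebraic_type :: "('a::field \<Rightarrow> ereal) \<Rightarrow> (nat \<Rightarrow> 'a) \<Rightarrow> bool" where
  "algebraic_type v s \<longleftrightarrow>
     (\<exists>f::'a poly. \<forall>\<^sub>F n in sequentially. v (poly f (s n)) < v (poly f (s (Suc n))))"

section \<open>Evaluation of rational functions\<close>

text \<open>The field \<open>K(X)\<close> is the type \<open>'a poly fract\<close>. The value of a rational function is
  unspecified at its poles.\<close>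

definition regular_at :: "'a::field poly fract \<Rightarrow> 'a \<Rightarrow> bool" where
  "regular_at \<phi> x \<longleftrightarrow> (\<exists>f g. \<phi> = Fract f g \<and> poly g x \<noteq> 0)"

definition rf_eval :: "'a::field poly fract \<Rightarrow> 'a \<Rightarrow> 'a" where
  "rf_eval \<phi> x = (THE y. \<exists>f g. \<phi> = Fract f g \<and> poly g x \<noteq> 0 \<and> y = poly f x / poly g x)"

lemma rf_eval_Fract:
  assumes "poly g x \<noteq> 0"
  shows "rf_eval (Fract f g) x = poly f x / poly g x"
  unfolding rf_eval_def
proof (rule the_equality)
  show "\<exists>f' g'. Fract f g = Fract f' g' \<and> poly g' x \<noteq> 0 \<and>
          poly f x / poly g x = poly f' x / poly g' x"
    using assms by blast
next
  fix y
  assume "\<exists>f' g'. Fract f g = Fract f' g' \<and> poly g' x \<noteq> 0 \<and> y = poly f' x / poly g' x"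
  then obtain f' g' where *: "Fract f g = Fract f' g'" "poly g' x \<noteq> 0" "y = poly f' x / poly g' x"
    by blast
  have "g \<noteq> 0" "g' \<noteq> 0"
    using assms *(2) by auto
  then have "f * g' = f' * g"
    using *(1) by (simp add: eq_fract)
  then have "poly f x * poly g' x = poly f' x * poly g x"
    by (metis poly_mult)
  then show "y = poly f x / poly g x"
    using assms * by (simp add: frac_eq_eq)
qed

section \<open>The valuation domains attached to a pseudo-convergent sequence\<close>

definition V_dom :: "'a::field set \<Rightarrow> (nat \<Rightarrow> 'a) \<Rightarrow> 'a poly fract set" where
  "V_dom V s = {\<phi>. \<forall>\<^sub>F n in sequentially. regular_at \<phi> (s n) \<and> rf_eval \<phi> (s n) \<in> V}"

text \<open>The terms of a pseudo-convergent sequence are distinct, so at most finitely many of them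
  are poles of \<open>\<phi>\<close> and these do not affect the limit.\<close>

definition w_val :: "('a::field \<Rightarrow> ereal) \<Rightarrow> (nat \<Rightarrow> 'a) \<Rightarrow> 'a poly fract \<Rightarrow> ereal" where
  "w_val v s \<phi> = lim (\<lambda>n. v (rf_eval \<phi> (s n)))"

definition w_is_valuation :: "('a::field \<Rightarrow> ereal) \<Rightarrow> (nat \<Rightarrow> 'a) \<Rightarrow> bool" where
  "w_is_valuation v s \<longleftrightarrow>
     (\<forall>\<phi>. convergent (\<lambda>n. v (rf_eval \<phi> (s n)))) \<and> real_valuation (w_val v s)"

definition W_dom :: "('a::field \<Rightarrow> ereal) \<Rightarrow> (nat \<Rightarrow> 'a) \<Rightarrow> 'a poly fract set" where
  "W_dom v s = {\<phi>. 0 \<le> w_val v s \<phi>}"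

definition ostrowski_domains :: "('a::field \<Rightarrow> ereal) \<Rightarrow> 'a poly fract set set" where
  "ostrowski_domains v = {W_dom v s | s. pseudo_convergent v s \<and> w_is_valuation v s}"

section \<open>The constructible topology\<close>

definition Zar :: "'a::field set \<Rightarrow> 'a poly fract set set" where
  "Zar V = {Z. valuation_domain Z \<and> (\<lambda>c. to_fract [:c:]) ` V \<subseteq> Z}"

definition Zar_basic :: "'a::field set \<Rightarrow> 'a poly fract set \<Rightarrow> 'a poly fract set set" where
  "Zar_basic V S = {Z \<in> Zar V. S \<subseteq> Z}"

definition Zar_cons :: "'a::field set \<Rightarrow> 'a poly fract set topology" where
  "Zar_cons V = topology_generated_by
     ({Zar_basic V S | S. finite S} \<union> {Zar V - Zar_basic V S | S. finite S})"

lemma topspace_Zar_cons [simp]: "topspace (Zar_cons V) = Zar V"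
proof -
  have "Zar V = Zar_basic V {}"
    by (simp add: Zar_basic_def)
  then show ?thesis
    by (auto simp: Zar_cons_def Zar_basic_def)
qed

end

theory Submission
  imports Defs
begin

text \<open>Write \<open>\<gamma>\<^sub>n = v(s\<^sub>n\<^sub>+\<^sub>1 - s\<^sub>n)\<close>. For a rational function \<open>\<phi> \<noteq> 0\<close> and all large \<open>n\<close>, the value
  \<open>v(\<phi>(s\<^sub>n))\<close> is an affine function of \<open>\<gamma>\<^sub>n\<close>, and \<open>v(\<phi>(t)) = v(\<phi>(s\<^sub>n))\<close> whenever
  \<open>v(t - s\<^sub>n) > \<gamma>\<^sub>n\<close>. Since \<open>\<zeta>\<^sub>n \<ge> \<delta> > \<gamma>\<^sub>n\<close>, almost all terms of \<open>E\<^sub>n\<close> are such \<open>t\<close>, so membership of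
  \<open>\<phi>\<close> in \<open>V\<^bsub>E\<^sub>n\<^esub>\<close> or \<open>W\<^bsub>E\<^sub>n\<^esub>\<close> is decided by the sign of \<open>v(\<phi>(s\<^sub>n))\<close>, which is eventually the one
  deciding membership in \<open>V\<^sub>E\<close>.

  To stay inside \<open>K\<close> instead of factoring over an algebraic closure, take \<open>q\<close> of minimal degree
  among the polynomials for which \<open>v(q(s\<^sub>n))\<close> is not eventually constant. In the Taylor expansion
  of \<open>q\<close> at \<open>s\<^sub>n\<close> the coefficients have eventually constant value, so a single term dominates; this
  gives the claim for \<open>q\<close>, and the expansion in powers of \<open>q\<close> gives it for all polynomials.\<close>

section \<open>Real-valued valuations\<close>

locale real_valued =
  fixes v :: "'a::field \<Rightarrow> ereal"
  assumes val: "real_valuation v"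
begin

lemma val_not_minf [simp]: "v x \<noteq> - \<infinity>"
  and val_eq_inf [simp]: "v x = \<infinity> \<longleftrightarrow> x = 0"
  and val_mult: "v (x * y) = v x + v y"
  and val_add_ge: "min (v x) (v y) \<le> v (x + y)"
  using val by (auto simp: real_valuation_def)

lemma val_0 [simp]: "v 0 = \<infinity>"
  by simp

lemma val_real: "x \<noteq> 0 \<Longrightarrow> \<exists>r. v x = ereal r"
  by (metis ereal_cases val_eq_inf val_not_minf)

lemma val_1 [simp]: "v 1 = 0"
proof -
  obtain r where r: "v 1 = ereal r"
    using val_real[of 1] by auto
  show ?thesis
    using val_mult[of 1 1] r by (simp add: zero_ereal_def)
qed

lemma val_minus [simp]: "v (- x) = v x"
proof -
  obtain r where r: "v (- 1) = ereal r"
    using val_real[of "- 1"] by auto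
  have "v (- 1) = 0"
    using val_mult[of "- 1" "- 1"] r by (simp add: zero_ereal_def)
  then show ?thesis
    using val_mult[of "- 1" x] by simp
qed

lemma val_diff_commute: "v (x - y) = v (y - x)"
  using val_minus[of "x - y"] by simp

lemma val_diff_ge: "min (v x) (v y) \<le> v (x - y)"
  using val_add_ge[of x "- y"] by simp

lemma val_add_less: "v (x + y) = v x" if "v x < v y"
proof (rule antisym)
  show "v x \<le> v (x + y)"
    using val_add_ge[of x y] that by (auto simp: min_def split: if_splits)
  have "min (v (x + y)) (v y) \<le> v x"
    using val_diff_ge[of "x + y" y] by simp
  then show "v (x + y) \<le> v x"
    using that by (auto simp: min_def split: if_splits)
qed

lemma val_power: "x \<noteq> 0 \<Longrightarrow> v x = ereal r \<Longrightarrow> v (x ^ n) = ereal (of_nat n * r)"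
  by (induction n) (auto simp: val_mult algebra_simps)

lemma val_inverse: "x \<noteq> 0 \<Longrightarrow> v (inverse x) = - v x"
proof -
  assume x: "x \<noteq> 0"
  obtain r r' where "v x = ereal r" "v (inverse x) = ereal r'"
    using x val_real by (metis inverse_nonzero_iff_nonzero)
  then show ?thesis
    using val_mult[of x "inverse x"] x by (simp add: zero_ereal_def)
qed

text \<open>The ultrametric inequality keeps the strict bound term by term;
  \<open>c < \<infinity>\<close> covers sums that collapse to 0, whose value is infinity.\<close>

lemma val_sum_greater:
  assumes "\<And>i. i \<in> I \<Longrightarrow> c < v (F i)" "c < \<infinity>"
  shows "c < v (sum F I)"
  using assms(1)
proof (induction I rule: infinite_finite_induct)
  case (insert x I)
  then have "c < min (v (F x)) (v (sum F I))"
    by simp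
  then show ?case
    using order.strict_trans2[OF _ val_add_ge[of "F x" "sum F I"]] insert.hyps by simp
qed (use assms(2) in auto)

lemma val_sum_unique_min:
  assumes "finite I" "k \<in> I" "F k \<noteq> 0" "\<And>i. i \<in> I - {k} \<Longrightarrow> v (F k) < v (F i)"
  shows "v (sum F I) = v (F k)"
proof -
  have "v (F k) < v (sum F (I - {k}))"
    using assms by (intro val_sum_greater) (auto simp: less_top[symmetric] top_ereal_def)
  then show ?thesis
    using assms(1,2) by (simp add: sum.remove val_add_less)
qed

end

section \<open>Taylor expansion\<close>

text \<open>This is the i-th derivative divided by i!. Binomial coefficients replace the division,
  so Taylor's formula holds in every characteristic.\<close>

definition hasse_deriv :: "nat \<Rightarrow> 'a::comm_ring_1 poly \<Rightarrow> 'a poly" where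
  "hasse_deriv i f = (\<Sum>j\<le>degree f. monom (of_nat (j choose i) * coeff f j) (j - i))"

lemma poly_taylor:
  fixes f :: "'a::comm_ring_1 poly"
  shows "poly f (x + y) = (\<Sum>i\<le>degree f. poly (hasse_deriv i f) x * y ^ i)"
proof -
  let ?d = "degree f"
  have "coeff f j * (x + y) ^ j =
      (\<Sum>i\<le>?d. of_nat (j choose i) * coeff f j * x ^ (j - i) * y ^ i)" if "j \<le> ?d" for j
  proof -
    have "coeff f j * (y + x) ^ j = (\<Sum>i\<le>j. of_nat (j choose i) * coeff f j * x ^ (j - i) * y ^ i)"
      by (simp add: binomial_ring sum_distrib_left mult_ac)
    \<comment> \<open>The added terms carry \<open>j choose i\<close> with i > j and vanish; a range
      independent of j allows the two sums to be exchanged.\<close>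
    also have "\<dots> = (\<Sum>i\<le>?d. of_nat (j choose i) * coeff f j * x ^ (j - i) * y ^ i)"
      using that by (intro sum.mono_neutral_left) (auto simp: binomial_eq_0)
    finally show ?thesis
      by (simp add: add.commute)
  qed
  then have "poly f (x + y) =
      (\<Sum>j\<le>?d. \<Sum>i\<le>?d. of_nat (j choose i) * coeff f j * x ^ (j - i) * y ^ i)"
    by (simp add: poly_altdef)
  also have "\<dots> = (\<Sum>i\<le>?d. \<Sum>j\<le>?d. of_nat (j choose i) * coeff f j * x ^ (j - i) * y ^ i)"
    by (rule sum.swap)
  also have "\<dots> = (\<Sum>i\<le>?d. poly (hasse_deriv i f) x * y ^ i)"
    by (simp add: hasse_deriv_def poly_sum poly_monom sum_distrib_right)
  finally show ?thesis .
qed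

lemma poly_taylor_diff:
  fixes f :: "'a::comm_ring_1 poly"
  shows "poly f t - poly f x = (\<Sum>i\<in>{1..degree f}. poly (hasse_deriv i f) x * (t - x) ^ i)"
proof -
  have "{..degree f} = insert 0 {1..degree f}"
    by auto
  moreover have "hasse_deriv 0 f = f"
    by (simp add: hasse_deriv_def poly_as_sum_of_monoms)
  ultimately show ?thesis
    using poly_taylor[of f x "t - x"] by simp
qed

text \<open>The strict drop lets an assumption on all polynomials of smaller degree apply to every
  nonconstant Taylor coefficient.\<close>

lemma degree_hasse_deriv_less:
  assumes "i \<in> {1..degree f}"
  shows "degree (hasse_deriv i f) < degree f"
proof -
  have "degree (hasse_deriv i f) \<le> degree f - i"
    unfolding hasse_deriv_def
    by (intro degree_sum_le) (auto intro: order.trans[OF degree_monom_le])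
  then show ?thesis
    using assms by auto
qed

section \<open>Eventual comparison of affine functions\<close>

text \<open>The difference of the two functions has nonzero slope, so along the strictly increasing
  \<open>g\<close> it changes sign at most once, whether or not \<open>g\<close> is bounded.\<close>

lemma eventually_affine_compare:
  fixes g :: "nat \<Rightarrow> real"
  assumes "strict_mono g" "a \<noteq> a'"
  shows "(\<forall>\<^sub>F n in sequentially. c + a * g n < c' + a' * g n) \<or>
    (\<forall>\<^sub>F n in sequentially. c' + a' * g n < c + a * g n)"
proof -
  \<comment> \<open>For positive slope, one nonnegative value at N forces positivity beyond N;
    otherwise all values are negative.\<close>
  have *: "(\<forall>\<^sub>F n in sequentially. 0 < e + b * g n) \<or> (\<forall>\<^sub>F n in sequentially. e + b * g n < 0)"
    if "0 < b" for b e :: real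
  proof (cases "\<exists>N. 0 \<le> e + b * g N")
    case True
    then obtain N where N: "0 \<le> e + b * g N"
      by blast
    have "0 < e + b * g n" if "n > N" for n
      using N \<open>0 < b\<close> strict_monoD[OF assms(1) that] mult_strict_left_mono[of "g N" "g n" b] by linarith
    then have "\<forall>\<^sub>F n in sequentially. 0 < e + b * g n"
      by (rule eventually_mono[OF eventually_gt_at_top])
    then show ?thesis ..
  qed (auto simp: not_le)
  show ?thesis
  proof (cases "a < a'")
    case True
    then show ?thesis
      using *[of "a' - a" "c' - c"] by (auto simp: algebra_simps)
  next
    case False
    then show ?thesis
      using *[of "a - a'" "c - c'"] assms(2) by (auto simp: algebra_simps)
  qed
qed

text \<open>The slopes are the indices, hence pairwise distinct. A newly inserted index only has to
  be compared with the previous minimizer.\<close>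

lemma eventually_affine_unique_min:
  fixes g :: "nat \<Rightarrow> real" and c :: "nat \<Rightarrow> real"
  assumes "strict_mono g" "finite I" "I \<noteq> {}"
  shows "\<exists>k\<in>I. \<forall>\<^sub>F n in sequentially. \<forall>i\<in>I - {k}. c k + real k * g n < c i + real i * g n"
  using assms(2,3)
proof (induction I rule: finite_ne_induct)
  case (insert x I)
  then obtain k where k: "k \<in> I"
    "\<forall>\<^sub>F n in sequentially. \<forall>i\<in>I - {k}. c k + real k * g n < c i + real i * g n"
    by blast
  have "real k \<noteq> real x"
    using k(1) insert.hyps by auto
  from eventually_affine_compare[OF assms(1) this] show ?case
  proof
    assume "\<forall>\<^sub>F n in sequentially. c k + real k * g n < c x + real x * g n"
    then have "\<forall>\<^sub>F n in sequentially. \<forall>i\<in>insert x I - {k}. c k + real k * g n < c i + real i * g n"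
      using k(2) by eventually_elim auto
    then show ?case
      using k(1) by blast
  next
    assume "\<forall>\<^sub>F n in sequentially. c x + real x * g n < c k + real k * g n"
    then have "\<forall>\<^sub>F n in sequentially. \<forall>i\<in>insert x I - {x}. c x + real x * g n < c i + real i * g n"
      using k(2)
    proof eventually_elim
      case (elim n)
      show ?case
      proof
        fix i assume "i \<in> insert x I - {x}"
        then show "c x + real x * g n < c i + real i * g n"
          using elim by (cases "i = k") (auto intro: order.strict_trans)
      qed
    qed
    then show ?case
      by blast
  qed
qed auto

section \<open>Values of polynomials along a pseudo-convergent sequence\<close>

locale pseudo_convergent_seq = real_valued v for v :: "'a::field \<Rightarrow> ereal" +
  fixes s :: "nat \<Rightarrow> 'a"
  assumes pc: "pseudo_convergent v s"
begin

definition gap :: "nat \<Rightarrow> real" where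
  "gap n = real_of_ereal (v (s (Suc n) - s n))"

lemma val_step: "v (s (Suc n) - s n) = ereal (gap n)"
proof -
  have "v (s (Suc n) - s n) < v (s (Suc (Suc n)) - s (Suc n))"
    using pc by (simp add: pseudo_convergent_def)
  then have "s (Suc n) - s n \<noteq> 0"
    by (metis less_ereal.simps(5) less_top linorder_not_less ereal_less_eq(1) val_0)
  then show ?thesis
    unfolding gap_def using val_real[of "s (Suc n) - s n"] by auto
qed

lemma strict_mono_gap: "strict_mono gap"
  using pc by (simp add: strict_mono_Suc_iff pseudo_convergent_def val_step)

text \<open>By telescoping: the steps after the n-th have larger value and cannot change the value
  of the difference.\<close>

lemma val_diff_seq:
  assumes "n < m"
  shows "v (s m - s n) = ereal (gap n)"
  using assms
proof (induction m)
  case (Suc m)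
  show ?case
  proof (cases "n = m")
    case False
    then have nm: "n < m"
      using Suc.prems by simp
    then have "v (s m - s n) < v (s (Suc m) - s m)"
      using Suc.IH strict_monoD[OF strict_mono_gap nm] by (simp add: val_step)
    from val_add_less[OF this] show ?thesis
      using Suc.IH nm by simp
  qed (simp add: val_step)
qed simp

lemma eventually_poly_nonzero:
  assumes "f \<noteq> 0"
  shows "\<forall>\<^sub>F n in sequentially. poly f (s n) \<noteq> 0"
proof -
  have "s m \<noteq> s n" if "n < m" for m n
    using val_diff_seq[OF that] by auto
  then have inj: "inj s"
    by (intro linorder_injI) metis
  have "finite (s -` {x. poly f x = 0})"
    using poly_roots_finite[OF assms] inj by (intro finite_vimageI) auto
  then show ?thesis
    by (simp add: cofinite_eq_sequentially[symmetric] eventually_cofinite vimage_def)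
qed

text \<open>The constant is an extended real, so the zero polynomial qualifies with value infinity
  and needs no exception in assumptions on all polynomials of small degree.\<close>

definition eventually_const :: "'a poly \<Rightarrow> bool" where
  "eventually_const f \<longleftrightarrow> (\<exists>c. \<forall>\<^sub>F n in sequentially. v (poly f (s n)) = c)"

lemma eventually_constD:
  assumes "eventually_const f" "f \<noteq> 0"
  shows "\<exists>c. \<forall>\<^sub>F n in sequentially. v (poly f (s n)) = ereal c"
proof -
  obtain c where c: "\<forall>\<^sub>F n in sequentially. v (poly f (s n)) = c"
    using assms(1) by (auto simp: eventually_const_def)
  obtain n where "v (poly f (s n)) = c" "poly f (s n) \<noteq> 0"
    using eventually_happens[OF eventually_conj[OF c eventually_poly_nonzero[OF assms(2)]]] by auto
  then obtain r where "c = ereal r"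
    using val_real by blast
  then show ?thesis
    using c by blast
qed

text \<open>In the expansion at \<open>s n\<close>, evaluated at a later \<open>s m\<close>, the
  i-th term has value c i + i * gap n. One index is eventually the strict minimum and fixes the
  value of the sum. Replacing \<open>s m\<close> by a point t closer to \<open>s n\<close> raises
  every term strictly.\<close>

lemma taylor_dominant_term:
  assumes const: "\<forall>h. degree h < degree f \<longrightarrow> eventually_const h"
  shows "(\<forall>x y. poly f x = poly f y) \<or>
    (\<exists>b k. 0 < k \<and> (\<forall>\<^sub>F n in sequentially.
       (\<forall>m>n. v (poly f (s m) - poly f (s n)) = ereal (b + real k * gap n)) \<and>
       (\<forall>t. ereal (gap n) < v (t - s n) \<longrightarrow> ereal (b + real k * gap n) < v (poly f t - poly f (s n)))))"
proof -
  define h where "h i = hasse_deriv i f" for i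
  \<comment> \<open>Zero coefficients are discarded, since their value is infinity and not a real
    constant.\<close>
  define I where "I = {i \<in> {1..degree f}. h i \<noteq> 0}"
  have finI: "finite I"
    by (simp add: I_def)
  have taylor: "poly f t - poly f x = (\<Sum>i\<in>I. poly (h i) x * (t - x) ^ i)" for t x
    unfolding poly_taylor_diff h_def I_def by (rule sum.mono_neutral_right) auto
  show ?thesis
  proof (cases "I = {}")
    case True
    then have "poly f x = poly f y" for x y
      using taylor[of x y] by simp
    then show ?thesis
      by blast
  next
    case False
    have "\<exists>c. \<forall>\<^sub>F n in sequentially. v (poly (h i) (s n)) = ereal c" if "i \<in> I" for i
      using that degree_hasse_deriv_less[of i f] by (intro eventually_constD const[rule_format]) (auto simp: I_def h_def)
    then obtain c where c: "\<And>i. i \<in> I \<Longrightarrow> \<forall>\<^sub>F n in sequentially. v (poly (h i) (s n)) = ereal (c i)"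
      by metis
    obtain k where k: "k \<in> I"
      "\<forall>\<^sub>F n in sequentially. \<forall>i\<in>I - {k}. c k + real k * gap n < c i + real i * gap n"
      using eventually_affine_unique_min[OF strict_mono_gap finI False] by blast
    have "\<forall>\<^sub>F n in sequentially. \<forall>i\<in>I. v (poly (h i) (s n)) = ereal (c i)"
      using c finI by (simp add: eventually_ball_finite)
    then have "\<forall>\<^sub>F n in sequentially.
       (\<forall>m>n. v (poly f (s m) - poly f (s n)) = ereal (c k + real k * gap n)) \<and>
       (\<forall>t. ereal (gap n) < v (t - s n) \<longrightarrow> ereal (c k + real k * gap n) < v (poly f t - poly f (s n)))"
      using k(2)
    proof eventually_elim
      case (elim n)
      have "v (poly f (s m) - poly f (s n)) = ereal (c k + real k * gap n)" if "n < m" for m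
      proof -
        have ne: "s m - s n \<noteq> 0"
          using val_diff_seq[OF that] by auto
        have term_val: "v (poly (h i) (s n) * (s m - s n) ^ i) = ereal (c i + real i * gap n)" if "i \<in> I" for i
          using that elim(1) val_power[OF ne val_diff_seq[OF \<open>n < m\<close>]] by (simp add: val_mult)
        have "v (\<Sum>i\<in>I. poly (h i) (s n) * (s m - s n) ^ i) = v (poly (h k) (s n) * (s m - s n) ^ k)"
        proof (rule val_sum_unique_min[OF finI k(1)])
          show "poly (h k) (s n) * (s m - s n) ^ k \<noteq> 0"
            using term_val[OF k(1)] by (metis PInfty_neq_ereal(1) val_0)
        qed (use term_val k(1) elim(2) in auto)
        then show ?thesis
          using term_val[OF k(1)] by (simp add: taylor)
      qed
      moreover have "ereal (c k + real k * gap n) < v (poly f t - poly f (s n))"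
        if t: "ereal (gap n) < v (t - s n)" for t
        unfolding taylor
      proof (rule val_sum_greater)
        fix i assume i: "i \<in> I"
        then have "0 < i"
          by (simp add: I_def)
        \<comment> \<open>This compares the terms at distance \<open>gap n\<close>; as i > 0, the
          larger value of \<open>t - s n\<close> makes the inequality strict even for i = k.\<close>
        have le: "c k + real k * gap n \<le> c i + real i * gap n"
          using elim(2) i by (cases "i = k") (auto intro: less_imp_le)
        show "ereal (c k + real k * gap n) < v (poly (h i) (s n) * (t - s n) ^ i)"
        proof (cases "t = s n")
          case True
          then show ?thesis
            using \<open>0 < i\<close> by (simp add: power_0_left)
        next
          case False
          then obtain r where r: "v (t - s n) = ereal r"
            using val_real[of "t - s n"] by auto
          have "real i * gap n < real i * r"
            using t r \<open>0 < i\<close> by simp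
          then show ?thesis
            using le elim(1) i False val_power[of "t - s n" r i] r by (simp add: val_mult)
        qed
      qed simp
      ultimately show ?case
        by blast
    qed
    moreover have "0 < k"
      using k(1) by (simp add: I_def)
    ultimately show ?thesis
      by blast
  qed
qed

text \<open>The parameter \<open>u\<close> is \<open>gap\<close> or, for expansions in powers of q,
  the value of q along the sequence, which gives q slope 1. The second conjunct is constancy on an
  open ball around \<open>s n\<close>.\<close>

definition affine_along :: "(nat \<Rightarrow> real) \<Rightarrow> 'a poly \<Rightarrow> real \<Rightarrow> real \<Rightarrow> bool" where
  "affine_along u f c r \<longleftrightarrow> (\<forall>\<^sub>F n in sequentially. v (poly f (s n)) = ereal (c + r * u n) \<and>
     (\<forall>t. ereal (gap n) < v (t - s n) \<longrightarrow> v (poly f t) = v (poly f (s n))))"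

lemma affine_along_eventually_const:
  assumes const: "\<And>h. degree h < d \<Longrightarrow> eventually_const h" and "degree f < d" "f \<noteq> 0"
  shows "\<exists>c. affine_along u f c 0"
proof -
  obtain c where c: "\<forall>\<^sub>F n in sequentially. v (poly f (s n)) = ereal c"
    using eventually_constD assms by blast
  have "\<forall>h. degree h < degree f \<longrightarrow> eventually_const h"
    using const assms(2) by simp
  from taylor_dominant_term[of f, OF this] have "affine_along u f c 0"
  proof (elim disjE exE conjE)
    assume *: "\<forall>x y. poly f x = poly f y"
    show ?thesis
      using c unfolding affine_along_def
      by eventually_elim (use * in \<open>metis add_0_right mult_zero_left\<close>)
  next
    fix b :: real and k :: nat
    assume "0 < k" and *: "\<forall>\<^sub>F n in sequentially.
       (\<forall>m>n. v (poly f (s m) - poly f (s n)) = ereal (b + real k * gap n)) \<and>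
       (\<forall>t. ereal (gap n) < v (t - s n) \<longrightarrow> ereal (b + real k * gap n) < v (poly f t - poly f (s n)))"
    obtain N where N: "\<And>n. n \<ge> N \<Longrightarrow> v (poly f (s n)) = ereal c"
      using c by (auto simp: eventually_sequentially)
    show ?thesis
      using * eventually_ge_at_top[of N] unfolding affine_along_def
    proof eventually_elim
      case (elim n)
      \<comment> \<open>Two consecutive values equal c, so their difference has value at least c.
        Hence c lies below the Taylor bound, and a nearby t cannot change the value.\<close>
      have "ereal c \<le> v (poly f (s (Suc n)) - poly f (s n))"
        using val_diff_ge[of "poly f (s (Suc n))" "poly f (s n)"] N[of n] N[of "Suc n"] elim(2) by simp
      then have "c \<le> b + real k * gap n"
        using elim(1) by auto
      have "v (poly f t) = v (poly f (s n))" if "ereal (gap n) < v (t - s n)" for t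
      proof -
        have "ereal (b + real k * gap n) < v (poly f t - poly f (s n))"
          using elim(1) that by blast
        then have "v (poly f (s n)) < v (poly f t - poly f (s n))"
          unfolding N[OF elim(2)] using \<open>c \<le> _\<close> by (metis ereal_less_eq(3) order.strict_trans1)
        from val_add_less[OF this] show ?thesis
          by simp
      qed
      then show ?case
        using N elim(2) by simp
    qed
  qed
  then show ?thesis
    by blast
qed

text \<open>For large n let \<eta> n be the value of q (s m) - q (s n) for all m > n. A smaller
  value of q (s n) would persist for all later m and make q eventually constant. A larger one would
  give q (s (Suc n)) the value \<eta> n, below its lower bound \<eta> (Suc n).\<close>

lemma minimal_nonconstant:
  assumes const: "\<And>h. degree h < degree q \<Longrightarrow> eventually_const h"
    and nc: "\<not> eventually_const q"
  shows "\<exists>b k. 0 < k \<and> affine_along gap q b (real k)"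
proof -
  have "\<not> (\<forall>x y. poly q x = poly q y)"
  proof
    assume *: "\<forall>x y. poly q x = poly q y"
    have "\<forall>\<^sub>F n in sequentially. v (poly q (s n)) = v (poly q 0)"
      by (rule always_eventually) (metis *)
    with nc show False
      by (auto simp: eventually_const_def)
  qed
  then obtain b and k :: nat where k: "0 < k" and ev: "\<forall>\<^sub>F n in sequentially.
       (\<forall>m>n. v (poly q (s m) - poly q (s n)) = ereal (b + real k * gap n)) \<and>
       (\<forall>t. ereal (gap n) < v (t - s n) \<longrightarrow> ereal (b + real k * gap n) < v (poly q t - poly q (s n)))"
    using taylor_dominant_term[of q] const by auto
  define \<eta> where "\<eta> n = b + real k * gap n" for n
  obtain N where N: "\<And>m n. n \<ge> N \<Longrightarrow> m > n \<Longrightarrow> v (poly q (s m) - poly q (s n)) = ereal (\<eta> n)"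
    "\<And>n t. n \<ge> N \<Longrightarrow> ereal (gap n) < v (t - s n) \<Longrightarrow> ereal (\<eta> n) < v (poly q t - poly q (s n))"
    using ev unfolding eventually_sequentially \<eta>_def by blast
  have ge: "ereal (\<eta> n) \<le> v (poly q (s n))" if "n \<ge> N" for n
  proof (rule ccontr)
    assume "\<not> ?thesis"
    then have "v (poly q (s m)) = v (poly q (s n))" if "m > n" for m
      using N(1)[OF \<open>n \<ge> N\<close> that] val_add_less[of "poly q (s n)" "poly q (s m) - poly q (s n)"] by simp
    then have "\<forall>\<^sub>F m in sequentially. v (poly q (s m)) = v (poly q (s n))"
      by (rule eventually_mono[OF eventually_gt_at_top])
    then have "eventually_const q"
      unfolding eventually_const_def by (rule exI)
    with nc show False
      by simp
  qed
  have eq: "v (poly q (s n)) = ereal (\<eta> n)" if "n \<ge> N" for n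
  proof (rule ccontr)
    assume "\<not> ?thesis"
    then have "ereal (\<eta> n) < v (poly q (s n))"
      using ge[OF that] by simp
    then have "v (poly q (s (Suc n))) = ereal (\<eta> n)"
      using N(1)[OF that, of "Suc n"] val_add_less[of "poly q (s (Suc n)) - poly q (s n)" "poly q (s n)"] by simp
    moreover have "\<eta> n < \<eta> (Suc n)"
      using k strict_monoD[OF strict_mono_gap, of n "Suc n"] by (simp add: \<eta>_def)
    ultimately show False
      using ge[of "Suc n"] that by simp
  qed
  have "v (poly q t) = v (poly q (s n))" if "n \<ge> N" "ereal (gap n) < v (t - s n)" for n t
    using N(2)[OF that] eq[OF that(1)] val_add_less[of "poly q (s n)" "poly q t - poly q (s n)"] by simp
  then have aff: "affine_along gap q b (real k)"
    unfolding affine_along_def \<eta>_def[symmetric]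
    using eq by (intro eventually_sequentiallyI[of N] conjI allI impI)
  show ?thesis
    by (rule exI[of _ b], rule exI[of _ k], rule conjI[OF k aff])
qed

lemma affine_along_mult:
  assumes "affine_along u f c r" "affine_along u f' c' r'"
  shows "affine_along u (f * f') (c + c') (r + r')"
  using assms unfolding affine_along_def
proof eventually_elim
  case (elim n)
  have "v (poly f t) = v (poly f (s n))" "v (poly f' t) = v (poly f' (s n))"
    if "ereal (gap n) < v (t - s n)" for t
    using elim that by blast+
  then have "v (poly (f * f') t) = v (poly (f * f') (s n))" if "ereal (gap n) < v (t - s n)" for t
    using that by (simp only: poly_mult val_mult)
  moreover have "v (poly (f * f') (s n)) = ereal (c + c' + (r + r') * u n)"
    using elim by (simp add: val_mult distrib_right del: val_eq_inf)
  ultimately show ?case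
    by blast
qed

text \<open>With distinct slopes one summand eventually has strictly smaller value at
  \<open>s n\<close>. Both values are unchanged on the ball around \<open>s n\<close>, so the same
  summand dominates there.\<close>

lemma affine_along_add:
  assumes "strict_mono u" "affine_along u f c r" "affine_along u f' c' r'" "r \<noteq> r'"
  shows "affine_along u (f + f') c r \<or> affine_along u (f + f') c' r'"
proof -
  have *: "affine_along u (f + f') c r" if "affine_along u f c r" "affine_along u f' c' r'"
    "\<forall>\<^sub>F n in sequentially. c + r * u n < c' + r' * u n" for f f' c r c' r'
    using that unfolding affine_along_def
  proof eventually_elim
    case (elim n)
    have less: "v (poly f (s n)) < v (poly f' (s n))"
      using elim by simp
    moreover have "v (poly f t) = v (poly f (s n))" "v (poly f' t) = v (poly f' (s n))"
      if "ereal (gap n) < v (t - s n)" for t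
      using elim that by blast+
    ultimately have "v (poly (f + f') t) = v (poly f (s n))" if "ereal (gap n) < v (t - s n)" for t
      using that val_add_less[of "poly f t" "poly f' t"] by (metis poly_add)
    moreover have "v (poly (f + f') (s n)) = v (poly f (s n))"
      using less by (simp add: val_add_less)
    ultimately show ?case
      using elim(1) by metis
  qed
  show ?thesis
    using eventually_affine_compare[OF assms(1,4), of c c'] *[OF assms(2,3)] *[OF assms(3,2)]
    by (auto simp: add.commute)
qed

text \<open>Induction along the expansion in powers of \<open>q\<close>: the coefficients have slope zero, so
  distinct powers have distinct slopes with respect to the values of \<open>q\<close>.\<close>

lemma affine_along_expansion:
  assumes const: "\<And>h. degree h < degree q \<Longrightarrow> eventually_const h"
    and q: "affine_along u q 0 1" "0 < degree q" and u: "strict_mono u" and "f \<noteq> 0"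
  shows "\<exists>c k. affine_along u f c (real k)"
  using \<open>f \<noteq> 0\<close>
proof (induction "degree f" arbitrary: f rule: less_induct)
  case less
  show ?case
  proof (cases "degree f < degree q")
    case True
    then show ?thesis
      using affine_along_eventually_const[OF const True less.prems, where u = u] by (metis of_nat_0)
  next
    case False
    have "q \<noteq> 0"
      using q(2) by auto
    define a where "a = f mod q"
    define h where "h = f div q"
    have f: "f = a + q * h"
      by (simp add: a_def h_def)
    have a: "a = 0 \<or> degree a < degree q"
      using degree_mod_less[OF \<open>q \<noteq> 0\<close>, of f] by (simp add: a_def)
    have "h \<noteq> 0"
    proof
      assume "h = 0"
      then have "f = a"
        using f by simp
      then show False
        using a less.prems False by auto
    qed
    have "degree (q * h) = degree q + degree h"
      using \<open>q \<noteq> 0\<close> \<open>h \<noteq> 0\<close> by (rule degree_mult_eq)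
    moreover from this have "degree f = degree (q * h)"
      unfolding f using a q(2) by (intro degree_add_eq_right) auto
    ultimately have "degree h < degree f"
      using q(2) by simp
    then obtain c k where "affine_along u h c (real k)"
      using less.hyps \<open>h \<noteq> 0\<close> by blast
    \<comment> \<open>The factor q adds 1 to the slope, so \<open>q * h\<close> has positive slope
      while the remainder has slope 0.\<close>
    from affine_along_mult[OF q(1) this] have qh: "affine_along u (q * h) c (real (Suc k))"
      by (simp add: add.commute)
    show ?thesis
    proof (cases "a = 0")
      case True
      then have "f = q * h"
        using f by simp
      then show ?thesis
        using qh by blast
    next
      case False
      then obtain c' where "affine_along u a c' (real 0)"
        using affine_along_eventually_const[OF const, of _ a u] a by auto
      from affine_along_add[OF u this qh] show ?thesis
        unfolding f[symmetric] by (metis of_nat_0_eq_iff of_nat_eq_iff nat.distinct(1))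
    qed
  qed
qed

text \<open>Algebraic type provides a polynomial whose values are not eventually constant, so one of
  least degree exists; expansion in its powers handles every f.\<close>

lemma affine_along_poly:
  assumes "algebraic_type v s" "f \<noteq> 0"
  shows "\<exists>c r. affine_along gap f c r"
proof -
  obtain p where p: "\<forall>\<^sub>F n in sequentially. v (poly p (s n)) < v (poly p (s (Suc n)))"
    using assms(1) by (auto simp: algebraic_type_def)
  have "\<not> eventually_const p"
  proof
    assume "eventually_const p"
    then obtain c N where N: "\<And>n. n \<ge> N \<Longrightarrow> v (poly p (s n)) = c"
      by (auto simp: eventually_const_def eventually_sequentially)
    obtain M where "\<And>n. n \<ge> M \<Longrightarrow> v (poly p (s n)) < v (poly p (s (Suc n)))"
      using p by (auto simp: eventually_sequentially)
    then show False
      using N[of "max N M"] N[of "Suc (max N M)"] by (metis le_SucI less_irrefl max.cobounded1 max.cobounded2)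
  qed
  then obtain q where q: "\<not> eventually_const q"
    "\<And>h. \<not> eventually_const h \<Longrightarrow> degree q \<le> degree h"
    using ex_has_least_nat[of "\<lambda>h. \<not> eventually_const h" p degree] by blast
  then have const: "eventually_const h" if "degree h < degree q" for h
    using that not_le by blast
  obtain b k where k: "0 < k" and aff: "affine_along gap q b (real k)"
    using minimal_nonconstant[OF const q(1)] by blast
  \<comment> \<open>For large n this is the value of q at \<open>s n\<close>; k > 0 makes it
    strictly increasing.\<close>
  define u where "u n = b + real k * gap n" for n
  have u: "strict_mono u"
    using strict_mono_gap k by (auto simp: strict_mono_def u_def)
  have "affine_along u q 0 1"
    using aff by (simp add: affine_along_def u_def)
  moreover have "0 < degree q"
  proof (rule ccontr)
    assume "\<not> 0 < degree q"
    then obtain x where "q = [:x:]"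
      by (auto elim: degree_eq_zeroE)
    then show False
      using q(1) by (auto simp: eventually_const_def)
  qed
  ultimately obtain c j where "affine_along u f c (real j)"
    using affine_along_expansion[OF const] u assms(2) by blast
  \<comment> \<open>Substituting u n = b + k * gap n turns slope j along \<open>u\<close> into slope
    j * k along \<open>gap\<close>.\<close>
  then have "affine_along gap f (c + real j * b) (real j * real k)"
    by (simp add: affine_along_def u_def algebra_simps)
  then show ?thesis
    by blast
qed

end

section \<open>Values of rational functions\<close>

lemma rf_eval_const [simp]: "regular_at (to_fract [:c:]) x" "rf_eval (to_fract [:c:]) x = c"
proof -
  have *: "poly 1 x \<noteq> 0"
    by simp
  show "regular_at (to_fract [:c:]) x"
    unfolding regular_at_def to_fract_def using * by blast
  show "rf_eval (to_fract [:c:]) x = c"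
    unfolding to_fract_def rf_eval_Fract[OF *] by simp
qed

lemma rf_eval_0 [simp]: "regular_at 0 x" "rf_eval 0 x = 0"
  using rf_eval_const[of 0 x] by simp_all

lemma rf_eval_1 [simp]: "regular_at 1 x" "rf_eval 1 x = 1"
  using rf_eval_const[of 1 x] by (simp_all add: one_pCons[symmetric])

lemma
  assumes "regular_at \<phi> x" "regular_at \<psi> x"
  shows regular_at_mult: "regular_at (\<phi> * \<psi>) x"
    and rf_eval_mult: "rf_eval (\<phi> * \<psi>) x = rf_eval \<phi> x * rf_eval \<psi> x"
    and regular_at_diff: "regular_at (\<phi> - \<psi>) x"
    and rf_eval_diff: "rf_eval (\<phi> - \<psi>) x = rf_eval \<phi> x - rf_eval \<psi> x"
proof -
  obtain f g f' g' where fg: "\<phi> = Fract f g" "poly g x \<noteq> 0" "\<psi> = Fract f' g'" "poly g' x \<noteq> 0"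
    using assms by (auto simp: regular_at_def)
  then have ne: "g \<noteq> 0" "g' \<noteq> 0" "poly (g * g') x \<noteq> 0"
    by auto
  have mult: "\<phi> * \<psi> = Fract (f * f') (g * g')"
    and diff: "\<phi> - \<psi> = Fract (f * g' - f' * g) (g * g')"
    using fg ne by simp_all
  show "regular_at (\<phi> * \<psi>) x" "regular_at (\<phi> - \<psi>) x"
    using mult diff ne(3) unfolding regular_at_def by blast+
  have eval: "rf_eval \<phi> x = poly f x / poly g x" "rf_eval \<psi> x = poly f' x / poly g' x"
    unfolding fg(1,3) by (rule rf_eval_Fract[OF fg(2)], rule rf_eval_Fract[OF fg(4)])
  show "rf_eval (\<phi> * \<psi>) x = rf_eval \<phi> x * rf_eval \<psi> x"
    unfolding mult rf_eval_Fract[OF ne(3)] eval by simp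
  show "rf_eval (\<phi> - \<psi>) x = rf_eval \<phi> x - rf_eval \<psi> x"
    unfolding diff rf_eval_Fract[OF ne(3)] eval
    using fg(2,4) by (simp add: diff_frac_eq)
qed

lemma
  assumes "regular_at \<phi> x" "rf_eval \<phi> x \<noteq> 0"
  shows regular_at_inverse: "regular_at (inverse \<phi>) x"
    and rf_eval_inverse: "rf_eval (inverse \<phi>) x = inverse (rf_eval \<phi> x)"
proof -
  obtain f g where fg: "\<phi> = Fract f g" "poly g x \<noteq> 0"
    using assms by (auto simp: regular_at_def)
  then have f: "poly f x \<noteq> 0"
    using assms(2) by (auto simp: rf_eval_Fract)
  have inv: "inverse \<phi> = Fract g f"
    using fg by simp
  show "regular_at (inverse \<phi>) x"
    using inv f unfolding regular_at_def by blast
  have "rf_eval (inverse \<phi>) x = poly g x / poly f x"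
    unfolding inv by (rule rf_eval_Fract[OF f])
  then show "rf_eval (inverse \<phi>) x = inverse (rf_eval \<phi> x)"
    unfolding fg(1) rf_eval_Fract[OF fg(2)] by simp
qed

locale algebraic_pseudo_convergent_seq = pseudo_convergent_seq +
  assumes alg: "algebraic_type v s"
begin

lemma rf_eval_affine:
  assumes "\<phi> \<noteq> 0"
  shows "\<exists>c r. \<forall>\<^sub>F n in sequentially. regular_at \<phi> (s n) \<and>
    v (rf_eval \<phi> (s n)) = ereal (c + r * gap n) \<and>
    (\<forall>t. ereal (gap n) < v (t - s n) \<longrightarrow>
       regular_at \<phi> t \<and> v (rf_eval \<phi> t) = v (rf_eval \<phi> (s n)))"
proof -
  obtain f g where \<phi>: "\<phi> = Fract f g" and g: "g \<noteq> 0"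
    by (cases \<phi>)
  have f: "f \<noteq> 0"
    using assms \<phi> by (auto simp: Zero_fract_def eq_fract g)
  have val_rf: "v (rf_eval \<phi> x) = v (poly f x) + - v (poly g x)" if "poly g x \<noteq> 0" for x
    using that by (simp add: \<phi> rf_eval_Fract divide_inverse val_mult val_inverse)
  have regular: "regular_at \<phi> x" if "poly g x \<noteq> 0" for x
    using that \<phi> by (auto simp: regular_at_def)
  obtain c r c' r' where "affine_along gap f c r" "affine_along gap g c' r'"
    using affine_along_poly[OF alg] f g by meson
  then have "\<forall>\<^sub>F n in sequentially. regular_at \<phi> (s n) \<and>
      v (rf_eval \<phi> (s n)) = ereal (c - c' + (r - r') * gap n) \<and>
      (\<forall>t. ereal (gap n) < v (t - s n) \<longrightarrow>
         regular_at \<phi> t \<and> v (rf_eval \<phi> t) = v (rf_eval \<phi> (s n)))"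
    using eventually_poly_nonzero[OF g] unfolding affine_along_def
  proof eventually_elim
    case (elim n)
    have "regular_at \<phi> t \<and> v (rf_eval \<phi> t) = v (rf_eval \<phi> (s n))" if "ereal (gap n) < v (t - s n)" for t
    proof -
      have eq: "v (poly f t) = v (poly f (s n))" "v (poly g t) = v (poly g (s n))"
        using elim that by blast+
      \<comment> \<open>The value of g at t equals that at \<open>s n\<close>, hence is finite, so t
        is no pole.\<close>
      then have "poly g t \<noteq> 0"
        using elim(3) by (metis val_eq_inf)
      then show ?thesis
        using eq regular val_rf elim(3) by simp
    qed
    moreover have "v (rf_eval \<phi> (s n)) = ereal (c - c' + (r - r') * gap n)"
      using elim by (simp add: val_rf algebra_simps del: val_eq_inf)
    ultimately show ?case
      using regular elim(3) by blast
  qed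
  then show ?thesis
    by blast
qed

lemma eventually_regular_at: "\<forall>\<^sub>F n in sequentially. regular_at \<phi> (s n)"
proof (cases "\<phi> = 0")
  case False
  then obtain c r where "\<forall>\<^sub>F n in sequentially. regular_at \<phi> (s n) \<and>
    v (rf_eval \<phi> (s n)) = ereal (c + r * gap n) \<and>
    (\<forall>t. ereal (gap n) < v (t - s n) \<longrightarrow>
       regular_at \<phi> t \<and> v (rf_eval \<phi> t) = v (rf_eval \<phi> (s n)))"
    using rf_eval_affine by blast
  then show ?thesis
    by (rule eventually_mono) blast
qed simp

lemma eventually_constant_near:
  "\<forall>\<^sub>F n in sequentially. \<forall>t. ereal (gap n) < v (t - s n) \<longrightarrow>
     regular_at \<phi> t \<and> v (rf_eval \<phi> t) = v (rf_eval \<phi> (s n))"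
proof (cases "\<phi> = 0")
  case False
  then obtain c r where "\<forall>\<^sub>F n in sequentially. regular_at \<phi> (s n) \<and>
    v (rf_eval \<phi> (s n)) = ereal (c + r * gap n) \<and>
    (\<forall>t. ereal (gap n) < v (t - s n) \<longrightarrow>
       regular_at \<phi> t \<and> v (rf_eval \<phi> t) = v (rf_eval \<phi> (s n)))"
    using rf_eval_affine by blast
  then show ?thesis
    by (rule eventually_mono) blast
qed simp

lemma eventually_val_affine:
  assumes "\<phi> \<noteq> 0"
  shows "\<exists>c r. \<forall>\<^sub>F n in sequentially. v (rf_eval \<phi> (s n)) = ereal (c + r * gap n)"
proof -
  obtain c r where "\<forall>\<^sub>F n in sequentially. regular_at \<phi> (s n) \<and>
    v (rf_eval \<phi> (s n)) = ereal (c + r * gap n) \<and>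
    (\<forall>t. ereal (gap n) < v (t - s n) \<longrightarrow>
       regular_at \<phi> t \<and> v (rf_eval \<phi> t) = v (rf_eval \<phi> (s n)))"
    using rf_eval_affine[OF assms] by blast
  then have "\<forall>\<^sub>F n in sequentially. v (rf_eval \<phi> (s n)) = ereal (c + r * gap n)"
    by (rule eventually_mono) blast
  then show ?thesis
    by blast
qed

lemma eventually_rf_eval_nonzero:
  assumes "\<phi> \<noteq> 0"
  shows "\<forall>\<^sub>F n in sequentially. rf_eval \<phi> (s n) \<noteq> 0"
proof -
  obtain c r where "\<forall>\<^sub>F n in sequentially. v (rf_eval \<phi> (s n)) = ereal (c + r * gap n)"
    using eventually_val_affine[OF assms] by blast
  then show ?thesis
    by eventually_elim auto
qed

text \<open>An affine function of the strictly increasing \<open>gap\<close> cannot oscillate around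
  zero. This is why \<open>V_dom\<close> contains x or its inverse.\<close>

lemma eventually_sign:
  "(\<forall>\<^sub>F n in sequentially. 0 \<le> v (rf_eval \<phi> (s n))) \<or>
   (\<forall>\<^sub>F n in sequentially. v (rf_eval \<phi> (s n)) < 0)"
proof (cases "\<phi> = 0")
  case False
  then obtain c r where *: "\<forall>\<^sub>F n in sequentially. v (rf_eval \<phi> (s n)) = ereal (c + r * gap n)"
    using eventually_val_affine by blast
  have "(\<forall>\<^sub>F n in sequentially. 0 \<le> c + r * gap n) \<or> (\<forall>\<^sub>F n in sequentially. c + r * gap n < 0)"
  proof (cases "r = 0")
    case True
    then show ?thesis
      by (cases "0 \<le> c") auto
  next
    case False
    \<comment> \<open>The second affine function is taken to be zero.\<close>
    from eventually_affine_compare[OF strict_mono_gap this, of c 0] show ?thesis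
      by (auto elim: eventually_mono)
  qed
  then show ?thesis
  proof
    assume "\<forall>\<^sub>F n in sequentially. 0 \<le> c + r * gap n"
    with * have "\<forall>\<^sub>F n in sequentially. 0 \<le> v (rf_eval \<phi> (s n))"
      by eventually_elim simp
    then show ?thesis ..
  next
    assume "\<forall>\<^sub>F n in sequentially. c + r * gap n < 0"
    with * have "\<forall>\<^sub>F n in sequentially. v (rf_eval \<phi> (s n)) < 0"
      by eventually_elim simp
    then show ?thesis ..
  qed
qed simp

section \<open>The valuation domains of a sequence of algebraic type\<close>

lemma mem_V_dom_iff:
  "\<phi> \<in> V_dom {x. 0 \<le> v x} s \<longleftrightarrow> (\<forall>\<^sub>F n in sequentially. 0 \<le> v (rf_eval \<phi> (s n)))"
  using eventually_regular_at[of \<phi>] by (simp add: V_dom_def eventually_conj_iff)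

lemma V_dom_in_Zar: "V_dom {x. 0 \<le> v x} s \<in> Zar {x. 0 \<le> v x}"
proof -
  have "x - y \<in> V_dom {x. 0 \<le> v x} s \<and> x * y \<in> V_dom {x. 0 \<le> v x} s"
    if "x \<in> V_dom {x. 0 \<le> v x} s" "y \<in> V_dom {x. 0 \<le> v x} s" for x y
  proof -
    have "\<forall>\<^sub>F n in sequentially. 0 \<le> v (rf_eval (x - y) (s n)) \<and> 0 \<le> v (rf_eval (x * y) (s n))"
      using that[unfolded mem_V_dom_iff] eventually_regular_at[of x] eventually_regular_at[of y]
    proof eventually_elim
      case (elim n)
      have "0 \<le> min (v (rf_eval x (s n))) (v (rf_eval y (s n)))"
        using elim by simp
      then have "0 \<le> v (rf_eval x (s n) - rf_eval y (s n))"
        using val_diff_ge order.trans by blast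
      then show ?case
        using elim by (simp add: rf_eval_diff rf_eval_mult val_mult)
    qed
    then show ?thesis
      by (simp add: mem_V_dom_iff eventually_conj_iff)
  qed
  moreover have "x \<in> V_dom {x. 0 \<le> v x} s \<or> inverse x \<in> V_dom {x. 0 \<le> v x} s" if "x \<noteq> 0" for x
  proof (rule disjCI)
    assume "inverse x \<notin> V_dom {x. 0 \<le> v x} s"
    then have "\<forall>\<^sub>F n in sequentially. v (rf_eval (inverse x) (s n)) < 0"
      using eventually_sign[of "inverse x"] by (simp add: mem_V_dom_iff)
    then have "\<forall>\<^sub>F n in sequentially. 0 \<le> v (rf_eval x (s n))"
      using eventually_regular_at[of x] eventually_rf_eval_nonzero[OF that]
    proof eventually_elim
      case (elim n)
      then have "- v (rf_eval x (s n)) < 0"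
        by (simp add: rf_eval_inverse val_inverse)
      then show ?case
        by (cases "v (rf_eval x (s n))") auto
    qed
    then show "x \<in> V_dom {x. 0 \<le> v x} s"
      by (simp add: mem_V_dom_iff)
  qed
  moreover have "0 \<in> V_dom {x. 0 \<le> v x} s" "1 \<in> V_dom {x. 0 \<le> v x} s"
    "(\<lambda>c. to_fract [:c:]) ` {x. 0 \<le> v x} \<subseteq> V_dom {x. 0 \<le> v x} s"
    by (auto simp: mem_V_dom_iff)
  ultimately show ?thesis
    unfolding Zar_def valuation_domain_def by blast
qed

end

section \<open>Breadth and pseudo-limits\<close>

context pseudo_convergent_seq
begin

lemma gap_tendsto_breadth: "(\<lambda>n. ereal (gap n)) \<longlonglongrightarrow> breadth v s"
proof -
  have "incseq (\<lambda>n. ereal (gap n))"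
    using strict_mono_gap by (auto intro!: incseq_SucI less_imp_le simp: strict_mono_Suc_iff)
  then have "(\<lambda>n. ereal (gap n)) \<longlonglongrightarrow> (SUP n. ereal (gap n))"
    by (rule LIMSEQ_SUP)
  then show ?thesis
    unfolding breadth_def val_step using limI by metis
qed

lemma gap_less_breadth: "ereal (gap n) < breadth v s"
proof -
  have "ereal (gap n) < ereal (gap (Suc n))"
    using strict_mono_gap by (simp add: strict_mono_Suc_iff)
  also have "\<dots> \<le> breadth v s"
  proof (rule incseq_le[OF _ gap_tendsto_breadth])
    show "incseq (\<lambda>n. ereal (gap n))"
      using strict_mono_gap by (auto intro!: incseq_SucI less_imp_le simp: strict_mono_Suc_iff)
  qed
  finally show ?thesis .
qed

text \<open>The step s (Suc n) - s n is the sum of a - s n and s (Suc n) - a, and the second summand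
  has strictly larger value.\<close>

lemma val_pseudo_limit:
  assumes "pseudo_limit v s a"
  shows "v (a - s n) = ereal (gap n)"
proof -
  have less: "v (a - s n) < v (a - s (Suc n))"
    using assms by (simp add: pseudo_limit_def)
  have "v ((a - s n) + (s (Suc n) - a)) = v (a - s n)"
    by (rule val_add_less) (use less in \<open>simp add: val_diff_commute[of "s (Suc n)"]\<close>)
  then show ?thesis
    by (simp add: val_step)
qed

text \<open>The witness is X - a. Through this lemma the results on sequences of algebraic type
  apply to each \<open>E n\<close>, with pseudo-limit \<open>s n\<close>.\<close>

lemma algebraic_type_if_pseudo_limit:
  assumes "pseudo_limit v s a"
  shows "algebraic_type v s"
proof -
  have "v (poly [:- a, 1:] (s n)) < v (poly [:- a, 1:] (s (Suc n)))" for n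
    using assms by (simp add: pseudo_limit_def val_diff_commute[of a])
  then show ?thesis
    unfolding algebraic_type_def by (intro exI[of _ "[:- a, 1:]"] always_eventually allI)
qed

end

section \<open>Limit values, the domains \<open>W_dom\<close>, and nearby sequences\<close>

context algebraic_pseudo_convergent_seq
begin

text \<open>A finite breadth z makes c + r * gap n converge to the real c + r * z. As
  \<open>w_val\<close> is defined through \<open>lim\<close>, convergence has to be known before
  computing with it.\<close>

lemma w_val_limit:
  assumes "breadth v s \<noteq> \<infinity>"
  shows "(\<lambda>n. v (rf_eval \<phi> (s n))) \<longlonglongrightarrow> w_val v s \<phi>" and "w_val v s \<phi> \<noteq> - \<infinity>"
proof -
  have "breadth v s \<noteq> - \<infinity>"
    using gap_less_breadth[of 0] by auto
  with assms obtain z where z: "breadth v s = ereal z"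
    by (cases "breadth v s") auto
  have "\<exists>l. (\<lambda>n. v (rf_eval \<phi> (s n))) \<longlonglongrightarrow> l \<and> l \<noteq> - \<infinity>"
  proof (cases "\<phi> = 0")
    case False
    then obtain c r where cr: "\<forall>\<^sub>F n in sequentially. v (rf_eval \<phi> (s n)) = ereal (c + r * gap n)"
      using eventually_val_affine by blast
    have "gap \<longlonglongrightarrow> z"
      using gap_tendsto_breadth z by simp
    then have "(\<lambda>n. ereal (c + r * gap n)) \<longlonglongrightarrow> ereal (c + r * z)"
      by (intro tendsto_ereal tendsto_intros)
    then have "(\<lambda>n. v (rf_eval \<phi> (s n))) \<longlonglongrightarrow> ereal (c + r * z)"
      using cr by (simp add: tendsto_cong)
    then show ?thesis
      by (intro exI[of _ "ereal (c + r * z)"]) simp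
  qed auto
  then obtain l where l: "(\<lambda>n. v (rf_eval \<phi> (s n))) \<longlonglongrightarrow> l" "l \<noteq> - \<infinity>"
    by blast
  moreover have "w_val v s \<phi> = l"
    unfolding w_val_def using l(1) by (rule limI)
  ultimately show "(\<lambda>n. v (rf_eval \<phi> (s n))) \<longlonglongrightarrow> w_val v s \<phi>" "w_val v s \<phi> \<noteq> - \<infinity>"
    by simp_all
qed

lemma w_val_unique:
  assumes "\<forall>\<^sub>F n in sequentially. v (rf_eval \<phi> (s n)) = c"
  shows "w_val v s \<phi> = c"
  unfolding w_val_def using assms by (intro limI tendsto_eventually)

lemma W_dom_in_Zar:
  assumes "breadth v s \<noteq> \<infinity>"
  shows "W_dom v s \<in> Zar {x. 0 \<le> v x}"
proof -
  note lim = w_val_limit(1)[OF assms]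
  have "x - y \<in> W_dom v s \<and> x * y \<in> W_dom v s" if "x \<in> W_dom v s" "y \<in> W_dom v s" for x y
  proof -
    have xy: "0 \<le> w_val v s x" "0 \<le> w_val v s y"
      using that by (auto simp: W_dom_def)
    have "\<forall>\<^sub>F n in sequentially.
        min (v (rf_eval x (s n))) (v (rf_eval y (s n))) \<le> v (rf_eval (x - y) (s n))"
      using eventually_regular_at[of x] eventually_regular_at[of y]
      by eventually_elim (simp add: rf_eval_diff val_diff_ge)
    then have "min (w_val v s x) (w_val v s y) \<le> w_val v s (x - y)"
      by (rule tendsto_le[OF sequentially_bot lim tendsto_min[OF lim lim]])
    then have diff: "0 \<le> w_val v s (x - y)"
      using xy by (auto simp: min_def split: if_splits)
    \<comment> \<open>Both limits are nonnegative, which avoids the points where extended addition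
      is discontinuous.\<close>
    have "(\<lambda>n. v (rf_eval x (s n)) + v (rf_eval y (s n))) \<longlonglongrightarrow> w_val v s x + w_val v s y"
      using xy by (intro tendsto_add_ereal_nonneg lim) auto
    moreover have "\<forall>\<^sub>F n in sequentially.
        v (rf_eval (x * y) (s n)) = v (rf_eval x (s n)) + v (rf_eval y (s n))"
      using eventually_regular_at[of x] eventually_regular_at[of y]
      by eventually_elim (simp add: rf_eval_mult val_mult)
    ultimately have "(\<lambda>n. v (rf_eval (x * y) (s n))) \<longlonglongrightarrow> w_val v s x + w_val v s y"
      by (simp add: tendsto_cong)
    then have "w_val v s (x * y) = w_val v s x + w_val v s y"
      using lim LIMSEQ_unique by blast
    then show ?thesis
      using diff xy by (simp add: W_dom_def)
  qed
  moreover have "x \<in> W_dom v s \<or> inverse x \<in> W_dom v s" if "x \<noteq> 0" for x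
  proof -
    have "\<forall>\<^sub>F n in sequentially. v (rf_eval (inverse x) (s n)) = - v (rf_eval x (s n))"
      using eventually_regular_at[of x] eventually_rf_eval_nonzero[OF that]
      by eventually_elim (simp add: rf_eval_inverse val_inverse)
    moreover have "(\<lambda>n. - v (rf_eval x (s n))) \<longlonglongrightarrow> - w_val v s x"
      by (intro tendsto_uminus_ereal lim)
    ultimately have "(\<lambda>n. v (rf_eval (inverse x) (s n))) \<longlonglongrightarrow> - w_val v s x"
      by (simp add: tendsto_cong)
    then have "w_val v s (inverse x) = - w_val v s x"
      using lim LIMSEQ_unique by blast
    then show ?thesis
      by (cases "w_val v s x") (auto simp: W_dom_def)
  qed
  moreover have "w_val v s (to_fract [:c:]) = v c" for c
    by (rule w_val_unique) simp
  then have "0 \<in> W_dom v s" "1 \<in> W_dom v s" "(\<lambda>c. to_fract [:c:]) ` {x. 0 \<le> v x} \<subseteq> W_dom v s"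
    using w_val_unique[of 0 \<infinity>] w_val_unique[of 1 0] by (auto simp: W_dom_def)
  ultimately show ?thesis
    unfolding Zar_def valuation_domain_def by blast
qed

text \<open>The value of \<open>e m - s n\<close> is the m-th gap of \<open>e\<close>, which tends
  to the breadth of \<open>e\<close> and so finally exceeds \<open>gap n\<close>: almost all terms
  of \<open>e\<close> lie in the ball where \<phi> has constant value.\<close>

lemma constant_along_nearby_seq:
  assumes "ereal (gap n) < breadth v e" "pseudo_convergent v e" "pseudo_limit v e (s n)"
    and near: "\<forall>t. ereal (gap n) < v (t - s n) \<longrightarrow>
      regular_at \<phi> t \<and> v (rf_eval \<phi> t) = v (rf_eval \<phi> (s n))"
  shows "\<forall>\<^sub>F m in sequentially. v (rf_eval \<phi> (e m)) = v (rf_eval \<phi> (s n))"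
proof -
  interpret e: pseudo_convergent_seq v e
    using assms(2) by unfold_locales
  have "\<forall>\<^sub>F m in sequentially. ereal (gap n) < ereal (e.gap m)"
    using e.gap_tendsto_breadth assms(1) by (rule order_tendstoD(1))
  then show ?thesis
  proof (rule eventually_mono)
    fix m assume "ereal (gap n) < ereal (e.gap m)"
    then have "ereal (gap n) < v (e m - s n)"
      using e.val_pseudo_limit[OF assms(3)] by (simp only: val_diff_commute)
    then show "v (rf_eval \<phi> (e m)) = v (rf_eval \<phi> (s n))"
      using near by blast
  qed
qed

text \<open>By the sign dichotomy, non-membership means eventually negative values, so the sign at a
  single large n decides membership.\<close>

lemma eventually_mem_V_dom_iff:
  "\<forall>\<^sub>F n in sequentially. 0 \<le> v (rf_eval \<phi> (s n)) \<longleftrightarrow> \<phi> \<in> V_dom {x. 0 \<le> v x} s"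
proof (cases "\<phi> \<in> V_dom {x. 0 \<le> v x} s")
  case True
  then show ?thesis
    by (simp add: mem_V_dom_iff)
next
  case False
  then have "\<forall>\<^sub>F n in sequentially. v (rf_eval \<phi> (s n)) < 0"
    using eventually_sign[of \<phi>] by (simp add: mem_V_dom_iff)
  then show ?thesis
    by eventually_elim (use False in \<open>simp add: not_le\<close>)
qed

end

section \<open>Convergence in the constructible topology\<close>

text \<open>Subbasic sets suffice: the condition passes to finite intersections and arbitrary
  unions, by induction on the generation of open sets.\<close>

lemma limitin_topology_generated_by:
  assumes "l \<in> \<Union>S" "\<And>U. U \<in> S \<Longrightarrow> l \<in> U \<Longrightarrow> eventually (\<lambda>x. f x \<in> U) F"
  shows "limitin (topology_generated_by S) f l F"
proof -
  have "l \<in> U \<longrightarrow> eventually (\<lambda>x. f x \<in> U) F" if "generate_topology_on S U" for U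
    using that
  proof induction
    case (Int A B)
    then show ?case
      by (auto simp: eventually_conj_iff)
  next
    case (UN K)
    show ?case
    proof
      assume "l \<in> \<Union>K"
      then obtain k where "k \<in> K" "eventually (\<lambda>x. f x \<in> k) F"
        using UN.IH by blast
      then show "eventually (\<lambda>x. f x \<in> \<Union>K) F"
        by (auto elim: eventually_mono)
    qed
  qed (use assms(2) in auto)
  then show ?thesis
    using assms(1) by (auto simp: limitin_def openin_topology_generated_by_iff)
qed

text \<open>A subbasic set tests only finitely many \<phi>, so the eventual conditions combine. An
  equivalence for each \<phi> settles the complements as well.\<close>

lemma limitin_Zar_cons:
  assumes Z: "Z \<in> Zar V" and D: "\<And>n. D n \<in> Zar V"
    and ev: "\<And>\<phi>. \<forall>\<^sub>F n in sequentially. \<phi> \<in> D n \<longleftrightarrow> \<phi> \<in> Z"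
  shows "limitin (Zar_cons V) D Z sequentially"
  unfolding Zar_cons_def
proof (rule limitin_topology_generated_by)
  have "Zar V = Zar_basic V {}"
    by (simp add: Zar_basic_def)
  then show "Z \<in> \<Union> ({Zar_basic V S |S. finite S} \<union> {Zar V - Zar_basic V S |S. finite S})"
    using Z by blast
next
  fix U
  assume U: "U \<in> {Zar_basic V S |S. finite S} \<union> {Zar V - Zar_basic V S |S. finite S}" and "Z \<in> U"
  then obtain S where S: "finite S" "U = Zar_basic V S \<or> U = Zar V - Zar_basic V S"
    by blast
  have "\<forall>\<^sub>F n in sequentially. \<forall>\<phi>\<in>S. \<phi> \<in> D n \<longleftrightarrow> \<phi> \<in> Z"
    using S(1) ev by (simp add: eventually_ball_finite)
  then show "\<forall>\<^sub>F n in sequentially. D n \<in> U"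
  proof eventually_elim
    case (elim n)
    then have "S \<subseteq> D n \<longleftrightarrow> S \<subseteq> Z"
      by blast
    then show ?case
      using S(2) \<open>Z \<in> U\<close> Z D[of n] by (auto simp: Zar_basic_def)
  qed
qed

theorem proposition6p9:
  fixes V :: "'a::field set"
    and v :: "'a \<Rightarrow> ereal"
    and s :: "nat \<Rightarrow> 'a"
    and \<delta> :: ereal
    and \<zeta> :: "nat \<Rightarrow> ereal"
    and E :: "nat \<Rightarrow> nat \<Rightarrow> 'a"
  assumes "rank_one_valuation_domain V v"
    and "ostrowski_domains v \<noteq> {}"
    and "pseudo_convergent v s"
    and "algebraic_type v s"
    and "breadth v s = \<delta>"
    and "\<And>n. \<zeta> n \<in> {\<delta>..\<infinity>}"
    and "\<And>n. pseudo_convergent v (E n)"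
    and "\<And>n. pseudo_limit v (E n) (s n)"
    and "\<And>n. breadth v (E n) = \<zeta> n"
  shows "limitin (Zar_cons V) (\<lambda>n. V_dom V (E n)) (V_dom V s) sequentially \<and>
         ((\<forall>n. \<zeta> n \<noteq> \<infinity>) \<longrightarrow>
            limitin (Zar_cons V) (\<lambda>n. W_dom v (E n)) (V_dom V s) sequentially)"
proof -
  have V: "V = {x. 0 \<le> v x}" and val: "real_valuation v"
    using assms(1) by (simp_all add: rank_one_valuation_domain_def)
  interpret algebraic_pseudo_convergent_seq v s
    using val assms(3,4) by unfold_locales
  have pc: "pseudo_convergent_seq v (E n)" for n
    using val assms(7) by unfold_locales
  have En: "algebraic_pseudo_convergent_seq v (E n)" for n
    using pseudo_convergent_seq.algebraic_type_if_pseudo_limit[OF pc assms(8)] val assms(7)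
    by unfold_locales
  \<comment> \<open>The chain is gap n < \<delta> \<le> \<zeta> n.\<close>
  have br: "ereal (gap n) < breadth v (E n)" for n
    using gap_less_breadth[of n] assms(5) assms(6)[of n] assms(9)[of n] by auto
  \<comment> \<open>For large n the sign at \<open>s n\<close> decides membership in
    \<open>V_dom V s\<close>, and the values along \<open>E n\<close> settle at the value at
    \<open>s n\<close>. Both limits follow from this.\<close>
  have const: "\<forall>\<^sub>F n in sequentially. (0 \<le> v (rf_eval \<phi> (s n)) \<longleftrightarrow> \<phi> \<in> V_dom V s) \<and>
      (\<forall>\<^sub>F m in sequentially. v (rf_eval \<phi> (E n m)) = v (rf_eval \<phi> (s n)))" for \<phi>
    using eventually_mem_V_dom_iff[of \<phi>] eventually_constant_near[of \<phi>] unfolding V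
    by eventually_elim (use constant_along_nearby_seq[OF br assms(7,8)] in blast)
  have "limitin (Zar_cons V) (\<lambda>n. V_dom V (E n)) (V_dom V s) sequentially"
  proof (rule limitin_Zar_cons)
    show "V_dom V s \<in> Zar V" "\<And>n. V_dom V (E n) \<in> Zar V"
      unfolding V using V_dom_in_Zar algebraic_pseudo_convergent_seq.V_dom_in_Zar[OF En] by auto
    show "\<forall>\<^sub>F n in sequentially. \<phi> \<in> V_dom V (E n) \<longleftrightarrow> \<phi> \<in> V_dom V s" for \<phi>
      using const[of \<phi>]
    proof (rule eventually_mono, elim conjE)
      fix n
      assume *: "0 \<le> v (rf_eval \<phi> (s n)) \<longleftrightarrow> \<phi> \<in> V_dom V s"
        and ev: "\<forall>\<^sub>F m in sequentially. v (rf_eval \<phi> (E n m)) = v (rf_eval \<phi> (s n))"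
      \<comment> \<open>The right-hand condition is independent of m, so it amounts to the sign
        condition at \<open>s n\<close>.\<close>
      have "(\<forall>\<^sub>F m in sequentially. 0 \<le> v (rf_eval \<phi> (E n m))) \<longleftrightarrow>
          (\<forall>\<^sub>F m in sequentially :: nat filter. 0 \<le> v (rf_eval \<phi> (s n)))"
        by (rule eventually_cong[OF ev]) simp
      then show "\<phi> \<in> V_dom V (E n) \<longleftrightarrow> \<phi> \<in> V_dom V s"
        using * algebraic_pseudo_convergent_seq.mem_V_dom_iff[OF En, of \<phi> n] by (simp add: V)
    qed
  qed
  moreover have "limitin (Zar_cons V) (\<lambda>n. W_dom v (E n)) (V_dom V s) sequentially"
    if "\<forall>n. \<zeta> n \<noteq> \<infinity>"
  proof (rule limitin_Zar_cons)
    show "V_dom V s \<in> Zar V"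
      unfolding V by (rule V_dom_in_Zar)
    \<comment> \<open>Finite breadth enters here, to make \<open>W_dom v (E n)\<close> a valuation
      domain.\<close>
    show "W_dom v (E n) \<in> Zar V" for n
      unfolding V using algebraic_pseudo_convergent_seq.W_dom_in_Zar[OF En] assms(9) that by simp
    show "\<forall>\<^sub>F n in sequentially. \<phi> \<in> W_dom v (E n) \<longleftrightarrow> \<phi> \<in> V_dom V s" for \<phi>
      using const[of \<phi>]
    proof (rule eventually_mono, elim conjE)
      fix n
      assume *: "0 \<le> v (rf_eval \<phi> (s n)) \<longleftrightarrow> \<phi> \<in> V_dom V s"
        and ev: "\<forall>\<^sub>F m in sequentially. v (rf_eval \<phi> (E n m)) = v (rf_eval \<phi> (s n))"
      \<comment> \<open>The limit of eventually constant values is that constant, so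
        \<open>w_val\<close> of \<open>E n\<close> at \<phi> is the value of \<phi> at
        \<open>s n\<close>.\<close>
      show "\<phi> \<in> W_dom v (E n) \<longleftrightarrow> \<phi> \<in> V_dom V s"
        using * algebraic_pseudo_convergent_seq.w_val_unique[OF En ev] by (simp add: W_dom_def)
    qed
  qed
  ultimately show ?thesis
    by blast
qed

end
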